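(* Let $t_n=(-1)^{s_2(n)}$, $h_0=0$, $h_1=1$, and $h_n=t_nh_{n-1}+h_{n-2}$ for $n\ge2$. For every integer $m\ge 2$, the sequence $(h_n \bmod m)_{n\in\mathbb{N}}$ (with values in $\{0,\ldots,m-1\}$) is $2$-automatic.
   Context: $s_2(n)$ denotes the number of 1's in the binary expansion of $n$; $(t_n)$ is the Prouhet–Thue–Morse sequence. A sequence $(a_n)_{n\in\mathbb{N}}$ with values in a finite set $\Delta$ is $k$-automatic if there is a deterministic finite automaton with output (finite state set $Q$, input alphabet $\{0,\ldots,k-1\}$, transition function $\delta:Q\times\{0,\ldots,k-1\}\to Q$, initial state $q_0$, output map $\tau:Q\to\Delta$) such that $a_n=\tau(\hat\delta(q_0,w))$ where $w$ is the base-$k$ representation of $n$ read from the most significant digit; equivalently, the $k$-kernel $\{(a_{k^in+j})_{n}: i\in\mathbb{N}, 0\le j<k^i\}$ is finite. *)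

theory Defs
  imports Complex_Main
begin

text \<open>Base-\<open>k\<close> representation without leading zeros, most significant digit first.
  The representation of \<open>0\<close> is the empty word. For \<open>k < 2\<close> the value is a dummy.\<close>

function base_digits :: "nat \<Rightarrow> nat \<Rightarrow> nat list" where
  "base_digits k n = (if k < 2 \<or> n = 0 then [] else base_digits k (n div k) @ [n mod k])"
  by auto
termination by (relation "Wellfounded.measure snd") auto

declare base_digits.simps [simp del]

definition binary_digit_sum :: "nat \<Rightarrow> nat" where
  "binary_digit_sum n = count_list (base_digits 2 n) 1"

definition thue_morse :: "nat \<Rightarrow> int" where
  "thue_morse n = (- 1) ^ binary_digit_sum n"

fun h :: "nat \<Rightarrow> int" where
  "h 0 = 0"
| "h (Suc 0) = 1"
| "h (Suc (Suc n)) = thue_morse (Suc (Suc n)) * h (Suc n) + h n"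

text \<open>Deterministic finite automata with output, over the input alphabet \<open>{0..<k}\<close> and with
  output alphabet \<open>\<Delta>\<close>. The behaviour of \<open>\<delta>\<close> and \<open>\<tau>\<close> outside the carriers is irrelevant.\<close>

locale dfao =
  fixes k :: nat
    and Q :: "'q set"
    and \<delta> :: "'q \<Rightarrow> nat \<Rightarrow> 'q"
    and q0 :: 'q
    and \<Delta> :: "'b set"
    and \<tau> :: "'q \<Rightarrow> 'b"
  assumes finite_states: "finite Q"
    and init_in: "q0 \<in> Q"
    and trans_in: "\<lbrakk>q \<in> Q; d < k\<rbrakk> \<Longrightarrow> \<delta> q d \<in> Q"
    and output_in: "q \<in> Q \<Longrightarrow> \<tau> q \<in> \<Delta>"

text \<open>Taking the states to be natural numbers loses no generality, since \<open>Q\<close> is finite.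
  The term \<open>foldl \<delta> q0 w\<close> is the state reached from \<open>q0\<close> after reading the word \<open>w\<close>
  from left to right.\<close>

definition automatic :: "nat \<Rightarrow> 'b set \<Rightarrow> (nat \<Rightarrow> 'b) \<Rightarrow> bool" where
  "automatic k \<Delta> a \<longleftrightarrow> k \<ge> 2 \<and> finite \<Delta> \<and>
     (\<exists>(Q :: nat set) \<delta> q0 \<tau>. dfao k Q \<delta> q0 \<Delta> \<tau> \<and>
        (\<forall>n. a n = \<tau> (foldl \<delta> q0 (base_digits k n))))"

end

theory Submission
  imports Defs "HOL-Library.FuncSet"
begin

text \<open>The pair \<open>(h n mod m, h (n - 1) mod m)\<close> arises from a fixed start vector by applying
  the maps \<open>u (t\<^sub>0), \<dots>, u (t\<^sub>n)\<close> on the finite set of residue pairs, where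
  \<open>u s (a, b) = (s a + b, a)\<close>. Since \<open>t\<^sub>2\<^sub>n = t\<^sub>n\<close> and \<open>t\<^sub>2\<^sub>n\<^sub>+\<^sub>1 = - t\<^sub>n\<close>, the product of length
  \<open>2n\<close> for \<open>u\<close> is the product of length \<open>n\<close> for \<open>s \<mapsto> u (- s) \<circ> u s\<close>. Hence the functional
  sending every family \<open>u\<close> of self-maps of a finite set to its product of length \<open>n\<close>, together
  with \<open>t\<^sub>n\<close>, takes finitely many values and determines the same data for \<open>2n\<close> and \<open>2n + 1\<close>:
  it is the state of an automaton.\<close>

text \<open>The classes of equal \<open>f\<close> serve as states, and \<open>step\<close> makes the
  transitions well defined on them. A chosen representative \<open>r n\<close> for each class keeps
  the states natural numbers, so \<open>a\<close> itself can be the output map.\<close>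

lemma automatic_if_finite_congruence:
  fixes f :: "nat \<Rightarrow> 'c"
  assumes k: "k \<ge> 2" and \<Delta>: "finite \<Delta>" "\<And>n. a n \<in> \<Delta>"
    and fin: "finite (range f)"
    and step: "\<And>n n' d. f n = f n' \<Longrightarrow> d < k \<Longrightarrow> f (k * n + d) = f (k * n' + d)"
    and out: "\<And>n n'. f n = f n' \<Longrightarrow> a n = a n'"
  shows "automatic k \<Delta> a"
proof -
  define r where "r n = inv f (f n)" for n
  have f_r: "f (r n) = f n" for n
    unfolding r_def by (simp add: f_inv_into_f)
  have r_eq: "r n = r n'" if "f n = f n'" for n n'
    using that by (simp add: r_def)
  define \<delta> where "\<delta> q d = r (k * q + d)" for q d
  have "range r = inv f ` range f"
    unfolding r_def by auto
  then have "finite (range r)"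
    using fin by simp
  then have "dfao k (range r) \<delta> (r 0) \<Delta> a"
    by unfold_locales (auto simp: \<delta>_def \<Delta>)
  moreover have "foldl \<delta> (r 0) (base_digits k n) = r n" for n
  proof (induction n rule: less_induct)
    case (less n)
    show ?case
    proof (cases "n = 0")
      case True
      then show ?thesis by (simp add: base_digits.simps)
    next
      case False
      then have "foldl \<delta> (r 0) (base_digits k n) = \<delta> (r (n div k)) (n mod k)"
        using k less.IH[of "n div k"] by (simp add: base_digits.simps[of k n])
      also have "\<dots> = r (k * (n div k) + n mod k)"
        unfolding \<delta>_def using k by (intro r_eq step f_r) simp
      finally show ?thesis by simp
    qed
  qed
  moreover have "a (r n) = a n" for n
    using f_r by (rule out)
  ultimately show ?thesis
    unfolding automatic_def using k \<Delta>(1)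
    by (intro conjI exI[of _ "range r"] exI[of _ \<delta>] exI[of _ "r 0"] exI[of _ a]) auto
qed

lemma thue_morse_0: "thue_morse 0 = 1"
  by (simp add: thue_morse_def binary_digit_sum_def base_digits.simps)

lemma thue_morse_double: "thue_morse (2 * n) = thue_morse n"
  by (cases "n = 0")
    (simp_all add: thue_morse_def binary_digit_sum_def base_digits.simps[of 2 "2 * n"])

lemma thue_morse_double_Suc: "thue_morse (Suc (2 * n)) = - thue_morse n"
  by (simp add: thue_morse_def binary_digit_sum_def base_digits.simps[of 2 "Suc (2 * n)"])

lemma thue_morse_in: "thue_morse n \<in> {1, -1}"
  unfolding thue_morse_def by (cases "even (binary_digit_sum n)") auto

fun thue_morse_prod :: "nat \<Rightarrow> (int \<Rightarrow> 'a \<Rightarrow> 'a) \<Rightarrow> 'a \<Rightarrow> 'a" where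
  "thue_morse_prod 0 u x = x"
| "thue_morse_prod (Suc n) u x = u (thue_morse n) (thue_morse_prod n u x)"

text \<open>Extensional function spaces make this set finite for finite \<open>X\<close>.\<close>

definition sign_families :: "'a set \<Rightarrow> (int \<Rightarrow> 'a \<Rightarrow> 'a) set" where
  "sign_families X = {1, -1} \<rightarrow>\<^sub>E (X \<rightarrow>\<^sub>E X)"

definition doubled_family :: "'a set \<Rightarrow> (int \<Rightarrow> 'a \<Rightarrow> 'a) \<Rightarrow> int \<Rightarrow> 'a \<Rightarrow> 'a" where
  "doubled_family X u = (\<lambda>s\<in>{1, -1}. compose X (u (- s)) (u s))"

definition thue_morse_state :: "'a set \<Rightarrow> nat \<Rightarrow> int \<times> ((int \<Rightarrow> 'a \<Rightarrow> 'a) \<times> 'a \<Rightarrow> 'a)" where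
  "thue_morse_state X n =
     (thue_morse n, \<lambda>(u, x)\<in>sign_families X \<times> X. thue_morse_prod n u x)"

lemma sign_families_apply:
  assumes "u \<in> sign_families X" "s \<in> {1, -1}" "x \<in> X"
  shows "u s x \<in> X"
  using assms unfolding sign_families_def by (meson PiE_mem)

lemma doubled_family_in:
  assumes "u \<in> sign_families X"
  shows "doubled_family X u \<in> sign_families X"
proof -
  have "compose X (u (- s)) (u s) \<in> X \<rightarrow>\<^sub>E X" if "s \<in> {1, -1}" for s
    using that sign_families_apply[OF assms]
    by (intro PiE_I) (auto simp: compose_def)
  then show ?thesis
    unfolding sign_families_def doubled_family_def by (intro restrict_PiE_iff[THEN iffD2] ballI)
qed

lemma doubled_family_apply:
  assumes "s \<in> {1, -1}" "x \<in> X"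
  shows "doubled_family X u s x = u (- s) (u s x)"
  unfolding doubled_family_def restrict_apply'[OF assms(1)] compose_eq[OF assms(2)] ..

lemma thue_morse_prod_in:
  assumes "u \<in> sign_families X" "x \<in> X"
  shows "thue_morse_prod n u x \<in> X"
  using assms by (induction n) (simp_all add: sign_families_apply thue_morse_in del: insert_iff)

lemma thue_morse_prod_double:
  assumes "u \<in> sign_families X" "x \<in> X"
  shows "thue_morse_prod (2 * n) u x = thue_morse_prod n (doubled_family X u) x"
proof (induction n)
  case 0
  then show ?case by simp
next
  case (Suc n)
  let ?y = "thue_morse_prod n (doubled_family X u) x"
  \<comment> \<open>\<open>compose X\<close> is undefined outside \<open>X\<close>, so the merged
    factor splits only at points of \<open>X\<close>.\<close>
  have "?y \<in> X"
    using assms by (intro thue_morse_prod_in doubled_family_in)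
  then have "doubled_family X u (thue_morse n) ?y = u (- thue_morse n) (u (thue_morse n) ?y)"
    by (intro doubled_family_apply thue_morse_in)
  then show ?case
    using Suc by (simp add: thue_morse_double thue_morse_double_Suc)
qed

lemma finite_range_thue_morse_state:
  assumes "finite X"
  shows "finite (range (thue_morse_state X))"
proof (rule finite_subset)
  show "range (thue_morse_state X) \<subseteq> {1, -1} \<times> (sign_families X \<times> X \<rightarrow>\<^sub>E X)"
    unfolding thue_morse_state_def
    by (intro image_subsetI SigmaI thue_morse_in restrict_PiE_iff[THEN iffD2])
      (auto intro: thue_morse_prod_in)
  have "finite (sign_families X)"
    unfolding sign_families_def using assms by (intro finite_PiE) auto
  then show "finite ({1, -1 :: int} \<times> (sign_families X \<times> X \<rightarrow>\<^sub>E X))"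
    using assms by (intro finite_cartesian_product finite_PiE) auto
qed

lemma thue_morse_state_eq_iff:
  "thue_morse_state X n = thue_morse_state X n' \<longleftrightarrow>
     thue_morse n = thue_morse n' \<and>
     (\<forall>u\<in>sign_families X. \<forall>x\<in>X. thue_morse_prod n u x = thue_morse_prod n' u x)"
  unfolding thue_morse_state_def by (auto simp: fun_eq_iff restrict_def)

text \<open>For \<open>d = 0\<close> the hypothesis is used at \<open>doubled_family X u\<close>
  instead of \<open>u\<close>; this is why a state covers all families. For \<open>d = 1\<close> the
  extra factor has sign \<open>thue_morse (2 * n) = thue_morse n\<close>, known from the first
  component.\<close>

lemma thue_morse_state_step:
  assumes "thue_morse_state X n = thue_morse_state X n'" "d < 2"
  shows "thue_morse_state X (2 * n + d) = thue_morse_state X (2 * n' + d)"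
proof -
  have "d = 0 \<or> d = 1"
    using assms(2) by auto
  with assms(1) show ?thesis
    by (auto simp: thue_morse_state_eq_iff thue_morse_double thue_morse_double_Suc
        thue_morse_prod_double doubled_family_in)
qed

theorem theorem1:
  fixes m :: int
  assumes "m \<ge> 2"
  shows "automatic 2 {0..m - 1} (\<lambda>n. h n mod m)"
proof -
  define X where "X = {0..m - 1} \<times> {0..m - 1}"
  define u where "u = (\<lambda>s\<in>{1, -1}. \<lambda>(a, b)\<in>X. ((s * a + b) mod m, a))"
  \<comment> \<open>Running the recurrence backwards gives \<open>h\<^sub>-\<^sub>1 = 1\<close> and \<open>h\<^sub>-\<^sub>2 = - 1\<close>.\<close>
  define x where "x = (1 :: int, m - 1)"
  have x: "x \<in> X"
    using assms by (simp add: x_def X_def)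
  have u: "u \<in> sign_families X"
    using assms by (auto simp: sign_families_def u_def X_def intro!: PiE_I)
  have u_apply: "u (thue_morse n) (a, b) = ((thue_morse n * a + b) mod m, a)"
    if "(a, b) \<in> X" for n a b
    using that thue_morse_in[of n] by (simp add: u_def)
  have mod_in: "(a mod m, b mod m) \<in> X" for a b
    using assms by (simp add: X_def)
  have prod_1: "thue_morse_prod (Suc 0) u x = (0, 1)"
    using u_apply[of 1 "m - 1" 0] x by (simp add: x_def thue_morse_0)
  \<comment> \<open>Length \<open>n + 2\<close> uses the signs with indices \<open>0\<close> to
    \<open>n + 1\<close>, hence ends at \<open>h (n + 1)\<close>. Length 1 is separate because its
    second entry has index -1.\<close>
  have prod_2: "thue_morse_prod (Suc (Suc n)) u x = (h (Suc n) mod m, h n mod m)" for n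
  proof (induction n)
    case 0
    have "thue_morse (Suc 0) = - 1"
      using thue_morse_double_Suc[of 0] by (simp add: thue_morse_0)
    then show ?case
      using u_apply[of 0 1 "Suc 0"] assms prod_1 by (simp add: X_def)
  next
    case (Suc n)
    have "thue_morse_prod (Suc (Suc (Suc n))) u x
        = u (thue_morse (Suc (Suc n))) (h (Suc n) mod m, h n mod m)"
      using Suc by simp
    also have "\<dots> = (h (Suc (Suc n)) mod m, h (Suc n) mod m)"
      unfolding u_apply[OF mod_in] h.simps by (auto intro!: mod_add_cong simp: mod_simps)
    finally show ?case .
  qed
  have h_eq: "h n mod m = fst (thue_morse_prod (Suc n) u x)" for n
    by (cases n) (simp_all only: prod_1 prod_2 h.simps fst_conv mod_0)
  show ?thesis
  proof (rule automatic_if_finite_congruence)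
    show "finite (range (thue_morse_state X))"
      by (rule finite_range_thue_morse_state) (simp add: X_def)
    \<comment> \<open>The last factor of the product of length \<open>n + 1\<close> has sign
      \<open>thue_morse n\<close>, so the state at \<open>n\<close> determines this product.\<close>
    show "h n mod m = h n' mod m" if "thue_morse_state X n = thue_morse_state X n'" for n n'
      using that u x by (simp add: h_eq thue_morse_state_eq_iff)
  qed (use assms in \<open>auto intro: thue_morse_state_step\<close>)
qed

end
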